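(* Let $\Omega\subset\mathbb{R}^2$ be an open, bounded, simply connected domain with Lipschitz boundary, let $\nu>0$, $\alpha>0$, $\beta>0$, $\delta\ge1$, $\gamma\in(0,1)$, and $f\in L^2(\Omega)$. Let $V_h^{CR}$, $A_{NC}$ and the constant $C_\Omega^{CR}>0$ be as in the context. Suppose $$\nu+\beta\gamma C_\Omega^{CR}>\beta(1+\gamma)^2C_\Omega^{CR}+\frac{2\alpha^2}{\beta},$$ and let $k_{CR}$ (the radius of the sphere $\{v\in V_h^{CR}:\|v\|_{L^2(\Omega)}=k_{CR}\}$) satisfy $$k_{CR}>\frac{C_\Omega^{CR}}{\nu\sqrt{\nu+\beta\gamma C_\Omega^{CR}-\beta(1+\gamma)^2C_\Omega^{CR}-\frac{2\alpha^2}{\beta}}}\,\|f\|_{L^2(\Omega)} .$$ Then the problem of finding $u_h^{CR}\in V_h^{CR}$ with $A_{NC}(u_h^{CR},\chi)=(f,\chi)$ for all $\chi\in V_h^{CR}$ admits at least one solution.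
   Context: $\mathcal T_h$ is a partition of $\Omega$ into shape-regular triangular or rectangular cells $K$, with set of edges $\mathcal E_h$ (interior and boundary). $$V_h^{CR}=\Big\{v\in L^2(\Omega): v|_K\in\mathbb P_1\ \text{for all }K\in\mathcal T_h,\ \int_E[v]\,ds=0\ \text{for all }E\in\mathcal E_h\Big\},$$ where $\mathbb P_1$ is the space of polynomials of degree at most 1, $[v]$ is the jump of $v$ across an interior edge and the trace of $v$ on a boundary edge. $\nabla_h$ is the piecewise gradient, $(\nabla_hv)|_K=\nabla(v|_K)$. The form $A_{NC}$ is $$A_{NC}(v,\chi)=\nu\,(\nabla_hv,\nabla_h\chi)+\alpha\,\big((v^{\delta},v^{\delta})^T\cdot\nabla_hv,\chi\big)-\beta\,\big(v(1-v^{\delta})(v^{\delta}-\gamma),\chi\big),$$ with $(\cdot,\cdot)$ the $L^2(\Omega)$ inner product. $C_\Omega^{CR}$ is the discrete Poincaré–Friedrichs constant: $\|v\|_{L^2(\Omega)}^2\le C_\Omega^{CR}\|\nabla_hv\|_{L^2(\Omega)}^2$ for all $v\in V_h^{CR}$. Power convention: if $\delta$ is an integer, $s^\delta$ is the usual power; if $\delta$ is not an integer, $s^{\delta}$ means $|s|^{\delta}$ for $s\in\mathbb{R}$. *)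

theory Defs
  imports "HOL-Analysis.Analysis"
begin

section \<open>Domains with Lipschitz boundary\<close>

text \<open>Near each boundary point, in suitable orthonormal coordinates \<open>(y \<bullet> e, y \<bullet> n)\<close>,
  the domain is the part strictly above the graph of a Lipschitz function.\<close>

definition lipschitz_boundary :: "(real^2) set \<Rightarrow> bool" where
  "lipschitz_boundary \<Omega> \<longleftrightarrow>
     (\<forall>x\<in>frontier \<Omega>. \<exists>r>0. \<exists>e n. \<exists>L. \<exists>\<phi>::real \<Rightarrow> real.
        norm e = 1 \<and> norm n = 1 \<and> e \<bullet> n = 0 \<and> L-lipschitz_on UNIV \<phi> \<and>
        \<Omega> \<inter> ball x r = {y \<in> ball x r. y \<bullet> n > \<phi> (y \<bullet> e)})"


section \<open>Meshes\<close>

definition triangle :: "(real^2) set \<Rightarrow> bool" where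
  "triangle K \<longleftrightarrow> (\<exists>a b c. \<not> collinear {a, b, c} \<and> K = convex hull {a, b, c})"

definition rectangle :: "(real^2) set \<Rightarrow> bool" where
  "rectangle K \<longleftrightarrow>
     (\<exists>a u w. u \<noteq> 0 \<and> w \<noteq> 0 \<and> u \<bullet> w = 0 \<and> K = convex hull {a, a + u, a + w, a + u + w})"

definition inball_diameter :: "(real^2) set \<Rightarrow> real" where
  "inball_diameter K = Sup {2 * r | r. r \<ge> 0 \<and> (\<exists>x. cball x r \<subseteq> K)}"

text \<open>\<open>\<sigma>\<close> is the shape-regularity constant. The cells are closed. Conformity (absence of hanging
  nodes) is not required.\<close>

definition mesh :: "real \<Rightarrow> (real^2) set \<Rightarrow> (real^2) set set \<Rightarrow> bool" where
  "mesh \<sigma> \<Omega> \<T> \<longleftrightarrow>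
     finite \<T> \<and> \<Union>\<T> = closure \<Omega> \<and>
     (\<forall>K\<in>\<T>. triangle K \<or> rectangle K) \<and>
     (\<forall>K\<in>\<T>. \<forall>K'\<in>\<T>. K \<noteq> K' \<longrightarrow> interior K \<inter> interior K' = {}) \<and>
     (\<forall>K\<in>\<T>. diameter K \<le> \<sigma> * inball_diameter K)"

text \<open>An edge is recorded by its endpoints together with the adjacent cell(s), the latter being
  needed for jumps. Every edge occurs with both orientations (and an interior one with both orders
  of its cells); this changes a jump at most by its sign. An interior edge is a common edge of two
  cells. A boundary edge is a side of a cell lying on \<open>frontier \<Omega>\<close>; taking components matters only
  for non-conforming meshes, where a side may lie on \<open>frontier \<Omega>\<close> just in part.\<close>

definition interior_edges ::
    "(real^2) set set \<Rightarrow> ((real^2) \<times> (real^2) \<times> (real^2) set \<times> (real^2) set) set" where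
  "interior_edges \<T> =
     {(a, b, K, K'). K \<in> \<T> \<and> K' \<in> \<T> \<and> K \<noteq> K' \<and> a \<noteq> b \<and> closed_segment a b = K \<inter> K'}"

definition boundary_edges ::
    "(real^2) set \<Rightarrow> (real^2) set set \<Rightarrow> ((real^2) \<times> (real^2) \<times> (real^2) set) set" where
  "boundary_edges \<Omega> \<T> =
     {(a, b, K). K \<in> \<T> \<and> a \<noteq> b \<and>
        (\<exists>S. S edge_of K \<and> closed_segment a b \<in> components (S \<inter> frontier \<Omega>))}"

text \<open>The line integral over the segment with endpoints \<open>a\<close>, \<open>b\<close> with respect to arc length.\<close>

definition edge_integral :: "real^2 \<Rightarrow> real^2 \<Rightarrow> (real^2 \<Rightarrow> real) \<Rightarrow> real" where
  "edge_integral a b q = dist a b * integral {0..1} (\<lambda>t. q (linepath a b t))"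


section \<open>The space \<open>L\<^sup>2\<close>\<close>

text \<open>Elements of \<open>L\<^sup>2(\<Omega>)\<close> are represented by functions; all notions below depend only on the values
  almost everywhere in \<open>\<Omega>\<close>.\<close>

definition L2 :: "(real^2) set \<Rightarrow> (real^2 \<Rightarrow> real) set" where
  "L2 \<Omega> = {f. f \<in> borel_measurable (lebesgue_on \<Omega>) \<and> integrable (lebesgue_on \<Omega>) (\<lambda>x. (f x)\<^sup>2)}"

definition L2_inner ::
    "(real^2) set \<Rightarrow> (real^2 \<Rightarrow> 'b::euclidean_space) \<Rightarrow> (real^2 \<Rightarrow> 'b) \<Rightarrow> real" where
  "L2_inner \<Omega> f g = integral\<^sup>L (lebesgue_on \<Omega>) (\<lambda>x. f x \<bullet> g x)"

definition L2_norm :: "(real^2) set \<Rightarrow> (real^2 \<Rightarrow> 'b::euclidean_space) \<Rightarrow> real" where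
  "L2_norm \<Omega> f = sqrt (L2_inner \<Omega> f f)"


section \<open>The Crouzeix--Raviart space\<close>

definition P1 :: "(real^2 \<Rightarrow> real) set" where
  "P1 = {p. \<exists>c g. \<forall>x. p x = c + g \<bullet> x}"

definition agrees_on :: "(real^2 \<Rightarrow> real) \<Rightarrow> (real^2) set \<Rightarrow> (real^2 \<Rightarrow> real) \<Rightarrow> bool" where
  "agrees_on v K p \<longleftrightarrow> (AE x in lebesgue_on K. v x = p x)"

text \<open>The restriction \<open>v|\<^sub>K\<close> as a polynomial on the whole plane (unique, as a cell has positive
  measure). Its values on the boundary of \<open>K\<close> are the traces of \<open>v|\<^sub>K\<close>.\<close>

definition cell_poly :: "(real^2 \<Rightarrow> real) \<Rightarrow> (real^2) set \<Rightarrow> real^2 \<Rightarrow> real" where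
  "cell_poly v K = (THE p. p \<in> P1 \<and> agrees_on v K p)"

definition V_CR :: "(real^2) set \<Rightarrow> (real^2) set set \<Rightarrow> (real^2 \<Rightarrow> real) set" where
  "V_CR \<Omega> \<T> =
     {v \<in> L2 \<Omega>.
        (\<forall>K\<in>\<T>. \<exists>p\<in>P1. agrees_on v K p) \<and>
        (\<forall>(a, b, K, K')\<in>interior_edges \<T>.
            edge_integral a b (\<lambda>x. cell_poly v K x - cell_poly v K' x) = 0) \<and>
        (\<forall>(a, b, K)\<in>boundary_edges \<Omega> \<T>. edge_integral a b (cell_poly v K) = 0)}"

definition grad :: "(real^2 \<Rightarrow> real) \<Rightarrow> real^2 \<Rightarrow> real^2" where
  "grad p x = (THE D. GDERIV p x :> D)"

text \<open>The piecewise gradient; its value on the mesh skeleton, a null set, is \<open>0\<close>.\<close>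

definition grad_h :: "(real^2) set set \<Rightarrow> (real^2 \<Rightarrow> real) \<Rightarrow> real^2 \<Rightarrow> real^2" where
  "grad_h \<T> v x = (\<Sum>K\<in>\<T>. indicat_real (interior K) x *\<^sub>R grad (cell_poly v K) x)"


section \<open>The discrete form\<close>

text \<open>The power convention: the usual power for integer exponents, \<open>\<bar>s\<bar>\<^sup>\<delta>\<close> otherwise.\<close>

definition gpow :: "real \<Rightarrow> real \<Rightarrow> real" where
  "gpow s \<delta> = (if \<delta> \<in> \<int> then s powi \<lfloor>\<delta>\<rfloor> else \<bar>s\<bar> powr \<delta>)"

definition A_NC ::
    "(real^2) set \<Rightarrow> (real^2) set set \<Rightarrow> real \<Rightarrow> real \<Rightarrow> real \<Rightarrow> real \<Rightarrow> real
      \<Rightarrow> (real^2 \<Rightarrow> real) \<Rightarrow> (real^2 \<Rightarrow> real) \<Rightarrow> real" where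
  "A_NC \<Omega> \<T> \<nu> \<alpha> \<beta> \<gamma> \<delta> v w =
     \<nu> * L2_inner \<Omega> (grad_h \<T> v) (grad_h \<T> w)
     + \<alpha> * L2_inner \<Omega> (\<lambda>x. (\<chi> i. gpow (v x) \<delta>) \<bullet> grad_h \<T> v x) w
     - \<beta> * L2_inner \<Omega> (\<lambda>x. v x * (1 - gpow (v x) \<delta>) * (gpow (v x) \<delta> - \<gamma>)) w"

end

theory Submission
  imports Defs "HOL-Homology.Brouwer_Degree"
begin

text \<open>On \<open>V\<^sub>h\<close>, Young's inequality and the Poincare--Friedrichs inequality give
  \<open>A\<^sub>N\<^sub>C(v,v) - (f,v) \<ge> m/2 \<parallel>\<nabla>\<^sub>hv\<parallel>\<^sup>2 - const\<close> with
  \<open>m = \<nu> - \<alpha>\<^sup>2/\<beta> - \<beta>C(1+\<gamma>\<^sup>2)/2 > 0\<close>. The coordinates with respect to a basis of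
  \<open>V\<^sub>h\<close> orthonormal for \<open>(\<nabla>\<^sub>hv, \<nabla>\<^sub>hw)\<close> turn the discrete problem into finding a zero of
  a continuous vector field on some \<open>\<real>\<^sup>n\<close> that points outwards on a large sphere, and such a zero exists
  because spheres are not contractible. Elements of \<open>V\<^sub>h\<close> are functions, not classes modulo
  null sets, so this form has a nontrivial kernel; by Poincare--Friedrichs the kernel does not affect
  the equation. As the dimension \<open>n\<close> depends on the mesh, \<open>\<real>\<^sup>n\<close> is a space of sequences.\<close>

section \<open>Zeros of vector fields and Galerkin systems\<close>

text \<open>Gaussian elimination, one equation at a time: a nonzero coefficient at a pivot
  \<open>p\<close> allows solving for \<open>x p\<close>, and substituting it into the other
  equations leaves one equation and one unknown fewer.\<close>

lemma underdetermined_system: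
  fixes A :: "'j \<Rightarrow> 'i \<Rightarrow> real"
  assumes "finite J" "finite I" "card J < card I"
  shows "\<exists>x. (\<exists>i\<in>I. x i \<noteq> 0) \<and> (\<forall>j\<in>J. (\<Sum>i\<in>I. A j i * x i) = 0)"
  using assms
proof (induction J arbitrary: I A rule: finite_induct)
  case empty
  then obtain i where "i \<in> I" by fastforce
  then show ?case by (auto intro!: exI[of _ "\<lambda>_. 1"])
next
  case (insert j J)
  show ?case
  proof (cases "\<forall>i\<in>I. A j i = 0")
    case True
    then show ?thesis using insert.IH[of I A] insert.hyps insert.prems by simp
  next
    case False
    then obtain p where p: "p \<in> I" "A j p \<noteq> 0" by blast
    define I' where "I' = I - {p}"
    have "card J < card I'"
      using insert.hyps insert.prems p by (simp add: I'_def)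
    then obtain x where x: "\<exists>i\<in>I'. x i \<noteq> 0"
      "\<forall>l\<in>J. (\<Sum>i\<in>I'. (A l i - A l p * A j i / A j p) * x i) = 0"
      using insert.IH[of I' "\<lambda>l i. A l i - A l p * A j i / A j p"] insert.prems
      unfolding I'_def by blast
    define s where "s = (\<Sum>i\<in>I'. A j i * x i)"
    define y where "y = (\<lambda>i. if i = p then - s / A j p else x i)"
    have sum_y: "(\<Sum>i\<in>I. A l i * y i) = (\<Sum>i\<in>I'. A l i * x i) - A l p * s / A j p" for l
    proof -
      have "(\<Sum>i\<in>I. A l i * y i) = A l p * y p + (\<Sum>i\<in>I'. A l i * y i)"
        unfolding I'_def using p insert.prems by (simp add: sum.remove)
      also have "(\<Sum>i\<in>I'. A l i * y i) = (\<Sum>i\<in>I'. A l i * x i)"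
        by (rule sum.cong) (auto simp: y_def I'_def)
      finally show ?thesis by (simp add: y_def)
    qed
    have "(\<Sum>i\<in>I. A l i * y i) = 0" if "l \<in> J" for l
    proof -
      have "(\<Sum>i\<in>I'. (A l i - A l p * A j i / A j p) * x i)
            = (\<Sum>i\<in>I'. A l i * x i) - (\<Sum>i\<in>I'. A l p / A j p * (A j i * x i))"
        by (simp add: sum_subtractf[symmetric] algebra_simps)
      also have "\<dots> = (\<Sum>i\<in>I'. A l i * x i) - A l p * s / A j p"
        unfolding s_def by (simp add: sum_distrib_left sum_divide_distrib mult.assoc)
      finally show ?thesis using x that sum_y by simp
    qed
    moreover have "(\<Sum>i\<in>I. A j i * y i) = 0"
      using sum_y[of j] p by (simp add: s_def)
    moreover have "\<exists>i\<in>I. y i \<noteq> 0"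
      using x(1) by (auto simp: y_def I'_def)
    ultimately show ?thesis by auto
  qed
qed

text \<open>If \<open>F\<close> had no zero, \<open>F/\<bar>F\<bar>\<close> would contract the sphere: on it, \<open>F\<close> is homotopic to the
  identity through nonvanishing fields, and to a constant by shrinking the radius.\<close>

lemma zero_of_outward_field:
  fixes F :: "(nat \<Rightarrow> real) \<Rightarrow> nat \<Rightarrow> real"
  assumes cont: "\<And>i. i < n \<Longrightarrow> continuous_on UNIV (\<lambda>x. F x i)"
    and R: "R > 0"
    and out: "\<And>x. (\<Sum>i<n. (x i)\<^sup>2) = R\<^sup>2 \<Longrightarrow> (\<Sum>i<n. F x i * x i) > 0"
  shows "\<exists>x. \<forall>i<n. F x i = 0"
proof (rule ccontr)
  assume no: "\<not> ?thesis"
  then have "n \<noteq> 0" by auto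
  then obtain p where n: "n = Suc p" by (cases n) auto
  define N where "N = (\<lambda>y::nat\<Rightarrow>real. sqrt (\<Sum>i<n. (y i)\<^sup>2))"
  \<comment> \<open>Cut off from index \<open>n\<close> on because points of
    \<open>nsphere p\<close> are sequences supported on the first \<open>Suc p\<close>
    coordinates.\<close>
  define \<rho> where "\<rho> = (\<lambda>(y::nat\<Rightarrow>real) i. if i < n then y i / N y else 0)"
  have N0: "N y \<noteq> 0" if "\<exists>i<n. y i \<noteq> 0" for y
  proof -
    have "(\<Sum>i<n. (y i)\<^sup>2) \<noteq> 0" using that by (subst sum_nonneg_eq_0_iff) auto
    then show ?thesis by (simp add: N_def)
  qed
  have N2: "(N y)\<^sup>2 = (\<Sum>i<n. (y i)\<^sup>2)" for y
    unfolding N_def by (simp add: sum_nonneg)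
  have N_sphere: "N x = 1" if "x \<in> topspace (nsphere p)" for x
    using that by (simp add: nsphere N_def n lessThan_Suc_atMost)
  have top: "topspace (nsphere p) = {x. (\<Sum>i<n. (x i)\<^sup>2) = 1 \<and> (\<forall>i\<ge>n. x i = 0)}"
    by (auto simp: nsphere n lessThan_Suc_atMost)
  \<comment> \<open>Normalizing a continuous family that vanishes nowhere on the cylinder over the
    sphere gives a homotopy of self-maps of the sphere; both deformations below are of this
    kind.\<close>
  have homotopy: "homotopic_with (\<lambda>_. True) (nsphere p) (nsphere p)
      (\<lambda>x. \<rho> (H (0, x))) (\<lambda>x. \<rho> (H (1, x)))"
    if H: "\<And>i. i < n \<Longrightarrow> continuous_on UNIV (\<lambda>z. H z i)"
      and H0: "\<And>t x. t \<in> {0..1} \<Longrightarrow> x \<in> topspace (nsphere p) \<Longrightarrow> \<exists>i<n. H (t, x) i \<noteq> 0"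
    for H :: "real \<times> (nat \<Rightarrow> real) \<Rightarrow> nat \<Rightarrow> real"
  proof -
    let ?X = "{0..1::real} \<times> topspace (nsphere p)"
    have NH: "N (H z) \<noteq> 0" if "z \<in> ?X" for z
      using that H0 by (cases z) (auto intro!: N0)
    have "continuous_on ?X (\<lambda>z. H z i)" if "i < n" for i
      using H[OF that] continuous_on_subset by blast
    then have "continuous_on ?X (\<lambda>z. N (H z))"
      unfolding N_def by (intro continuous_intros) auto
    then have "continuous_on ?X (\<lambda>z. \<rho> (H z) i)" for i
      using NH \<open>\<And>i. i < n \<Longrightarrow> continuous_on ?X (\<lambda>z. H z i)\<close>
      by (cases "i < n") (auto simp: \<rho>_def intro!: continuous_intros)
    then have c: "continuous_on ?X (\<lambda>z. \<rho> (H z))"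
      by (intro continuous_on_coordinatewise_then_product)
    have "(\<lambda>z. \<rho> (H z)) \<in> ?X \<rightarrow> topspace (nsphere p)"
    proof
      fix z assume "z \<in> ?X"
      then have "N (H z) \<noteq> 0" by (rule NH)
      have "(\<Sum>i<n. (\<rho> (H z) i)\<^sup>2) = (\<Sum>i<n. (H z i)\<^sup>2) / (N (H z))\<^sup>2"
        by (simp add: \<rho>_def power_divide sum_divide_distrib)
      also have "\<dots> = 1" using \<open>N (H z) \<noteq> 0\<close> by (simp add: N2[symmetric])
      finally show "\<rho> (H z) \<in> topspace (nsphere p)" by (simp add: top \<rho>_def)
    qed
    with c have "continuous_map (top_of_set ?X) (top_of_set (topspace (nsphere p))) (\<lambda>z. \<rho> (H z))"
      by (simp add: image_subset_iff_funcset)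
    \<comment> \<open>The abstract topology of \<open>nsphere\<close> is the subspace topology of
      the function type, so continuity can be checked by \<open>continuous_on\<close>.\<close>
    moreover have s: "nsphere p = top_of_set (topspace (nsphere p))"
      by (simp add: nsphere_def Euclidean_space_def euclidean_product_topology subtopology_subtopology)
    moreover have "prod_topology (top_of_set {0..1::real}) (nsphere p) = top_of_set ?X"
      by (subst s) (simp add: prod_topology_subtopology_eu)
    ultimately have "continuous_map (prod_topology (top_of_set {0..1}) (nsphere p)) (nsphere p) (\<lambda>z. \<rho> (H z))"
      by simp
    then show ?thesis
      unfolding homotopic_with_def by (intro exI[of _ "\<lambda>z. \<rho> (H z)"]) auto
  qed
  have cF: "continuous_on UNIV (\<lambda>z. F (g z) i)" if "i < n" "continuous_on UNIV g"
    for i and g :: "real \<times> (nat \<Rightarrow> real) \<Rightarrow> nat \<Rightarrow> real"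
    using continuous_on_compose2[OF cont[OF that(1)] that(2)] by simp
  have coord: "continuous_on UNIV (\<lambda>z::real \<times> (nat\<Rightarrow>real). snd z i)" for i
    by (rule continuous_on_product_then_coordinatewise) (rule continuous_on_snd[OF continuous_on_id])
  \<comment> \<open>\<open>G1\<close> lets the radius grow from 0, where the field is constant, to
    \<open>R\<close>; \<open>G2\<close> joins the identity to the same final field by segments.
    Gluing them at time 1 contracts the sphere.\<close>
  define G1 where "G1 = (\<lambda>(z::real \<times> (nat\<Rightarrow>real)) i. F (\<lambda>j. fst z * R * snd z j) i)"
  define G2 where "G2 = (\<lambda>(z::real \<times> (nat\<Rightarrow>real)) i.
      (1 - fst z) * snd z i + fst z * F (\<lambda>j. R * snd z j) i)"
  have "homotopic_with (\<lambda>_. True) (nsphere p) (nsphere p) (\<lambda>x. \<rho> (G1 (0, x))) (\<lambda>x. \<rho> (G1 (1, x)))"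
  proof (rule homotopy)
    show "continuous_on UNIV (\<lambda>z. G1 z i)" if "i < n" for i
      unfolding G1_def
      by (intro cF that continuous_on_coordinatewise_then_product continuous_intros coord)
    show "\<exists>i<n. G1 (t, x) i \<noteq> 0" for t x
      using no by (auto simp: G1_def)
  qed
  moreover have "homotopic_with (\<lambda>_. True) (nsphere p) (nsphere p) (\<lambda>x. \<rho> (G2 (0, x))) (\<lambda>x. \<rho> (G2 (1, x)))"
  proof (rule homotopy)
    show "continuous_on UNIV (\<lambda>z. G2 z i)" if "i < n" for i
      unfolding G2_def
      by (intro cF that continuous_on_coordinatewise_then_product continuous_intros coord)
    show "\<exists>i<n. G2 (t, x) i \<noteq> 0" if t: "t \<in> {0..1}" and x: "x \<in> topspace (nsphere p)" for t x
    proof (rule ccontr)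
      assume "\<not> ?thesis"
      \<comment> \<open>Pairing with \<open>x\<close> gives a convex combination of 1 and a positive
        number, so \<open>G2\<close> cannot vanish.\<close>
      then have "0 = (\<Sum>i<n. G2 (t, x) i * x i)" by simp
      also have "\<dots> = (1 - t) * (\<Sum>i<n. (x i)\<^sup>2) + t * (\<Sum>i<n. F (\<lambda>j. R * x j) i * x i)"
        by (simp add: G2_def sum_distrib_left sum.distrib[symmetric] algebra_simps power2_eq_square)
      finally have "0 = (1 - t) + t * (\<Sum>i<n. F (\<lambda>j. R * x j) i * x i)"
        using x by (simp add: top)
      moreover have "(\<Sum>i<n. F (\<lambda>j. R * x j) i * x i) > 0"
      proof -
        have "(\<Sum>i<n. (R * x i)\<^sup>2) = R\<^sup>2"
          using x by (simp add: top power_mult_distrib sum_distrib_left[symmetric])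
        then have "0 < (\<Sum>i<n. F (\<lambda>j. R * x j) i * (R * x i))" by (rule out)
        also have "\<dots> = R * (\<Sum>i<n. F (\<lambda>j. R * x j) i * x i)"
          by (simp add: sum_distrib_left algebra_simps)
        finally show ?thesis using R by (simp add: zero_less_mult_iff)
      qed
      ultimately show False
        using t by (smt (verit) atLeastAtMost_iff mult_nonneg_nonneg mult_pos_pos)
    qed
  qed
  moreover have "(\<lambda>x. \<rho> (G1 (1, x))) = (\<lambda>x. \<rho> (G2 (1, x)))"
    by (simp add: G1_def G2_def)
  moreover have "(\<lambda>x. \<rho> (G1 (0, x))) = (\<lambda>x. \<rho> (F (\<lambda>_. 0)))"
    by (simp add: G1_def)
  ultimately have "homotopic_with (\<lambda>_. True) (nsphere p) (nsphere p)
      (\<lambda>x. \<rho> (G2 (0, x))) (\<lambda>x. \<rho> (F (\<lambda>_. 0)))"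
    by (metis (no_types, lifting) homotopic_with_symD homotopic_with_trans)
  moreover have "\<rho> (G2 (0, x)) = x" if "x \<in> topspace (nsphere p)" for x
  proof
    have "G2 (0, x) = x" by (simp add: G2_def)
    then show "\<rho> (G2 (0, x)) i = x i" for i
      using that N_sphere[OF that] by (auto simp: \<rho>_def top)
  qed
  ultimately have "homotopic_with (\<lambda>_. True) (nsphere p) (nsphere p) id (\<lambda>x. \<rho> (F (\<lambda>_. 0)))"
    by (elim homotopic_with_eq) auto
  then have "contractible_space (nsphere p)"
    unfolding contractible_space_def by blast
  then show False using non_contractible_space_nsphere by blast
qed

section \<open>Subspaces of functions and linear functionals on them\<close>

locale function_subspace =
  fixes V :: "('x \<Rightarrow> real) set"
  assumes zero: "(\<lambda>_. 0) \<in> V"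
    and comb: "\<And>c d u v. u \<in> V \<Longrightarrow> v \<in> V \<Longrightarrow> (\<lambda>p. c * u p + d * v p) \<in> V"
begin

text \<open>Linearity is asked on \<open>V\<close> only: quantities defined through
  \<open>cell_poly\<close> or by integrals need not be linear elsewhere. The vector-valued target
  also covers the gradient at a point.\<close>

definition linear_functional :: "(('x \<Rightarrow> real) \<Rightarrow> 'y::real_vector) \<Rightarrow> bool" where
  "linear_functional L \<longleftrightarrow>
     (\<forall>u\<in>V. \<forall>v\<in>V. \<forall>c d. L (\<lambda>p. c * u p + d * v p) = c *\<^sub>R L u + d *\<^sub>R L v)"

lemma linear_functionalD:
  "linear_functional L \<Longrightarrow> u \<in> V \<Longrightarrow> v \<in> V \<Longrightarrow> L (\<lambda>p. c * u p + d * v p) = c *\<^sub>R L u + d *\<^sub>R L v"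
  by (simp add: linear_functional_def)

lemma scale: "u \<in> V \<Longrightarrow> (\<lambda>p. c * u p) \<in> V"
  using comb[of u u c 0] by simp

lemma linear_functional_scale:
  "linear_functional L \<Longrightarrow> u \<in> V \<Longrightarrow> L (\<lambda>p. c * u p) = c *\<^sub>R L u"
  using linear_functionalD[of L u u c 0] by simp

lemma sum_mem:
  assumes "finite I" "\<And>i. i \<in> I \<Longrightarrow> b i \<in> V"
  shows "(\<lambda>p. \<Sum>i\<in>I. x i * b i p) \<in> V"
  using assms
proof (induction I rule: finite_induct)
  case empty
  then show ?case by (simp add: zero)
next
  case (insert i I)
  then show ?case using comb[of "b i" "\<lambda>p. \<Sum>i\<in>I. x i * b i p" "x i" 1] by simp
qed

lemma linear_functional_sum:
  assumes L: "linear_functional L" and "finite I" "\<And>i. i \<in> I \<Longrightarrow> b i \<in> V"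
  shows "L (\<lambda>p. \<Sum>i\<in>I. x i * b i p) = (\<Sum>i\<in>I. x i *\<^sub>R L (b i))"
  using assms(2,3)
proof (induction I rule: finite_induct)
  case empty
  then show ?case using linear_functional_scale[OF L zero, of 0] by simp
next
  case (insert i I)
  then show ?case
    using linear_functionalD[OF L, of "b i" "\<lambda>p. \<Sum>i\<in>I. x i * b i p" "x i" 1] sum_mem[of I b x]
    by simp
qed

end

section \<open>Semidefinite forms: orthonormal families and Galerkin systems\<close>

locale psd_form = function_subspace V for V :: "('x \<Rightarrow> real) set" +
  fixes a :: "('x \<Rightarrow> real) \<Rightarrow> ('x \<Rightarrow> real) \<Rightarrow> real"
  assumes a_linear: "\<And>w. w \<in> V \<Longrightarrow> linear_functional (\<lambda>v. a v w)"
    and a_sym: "\<And>v w. a v w = a w v"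
    and a_nonneg: "\<And>v. v \<in> V \<Longrightarrow> a v v \<ge> 0"
begin

definition orthonormal :: "nat \<Rightarrow> (nat \<Rightarrow> 'x \<Rightarrow> real) \<Rightarrow> bool" where
  "orthonormal n b \<longleftrightarrow>
     (\<forall>i<n. b i \<in> V) \<and> (\<forall>i<n. \<forall>j<n. a (b i) (b j) = (if i = j then 1 else 0))"

lemma orthonormal_coefficient:
  assumes "orthonormal n b" "j < n"
  shows "a (\<lambda>p. \<Sum>i<n. x i * b i p) (b j) = x j"
proof -
  have "a (\<lambda>p. \<Sum>i<n. x i * b i p) (b j) = (\<Sum>i<n. x i * a (b i) (b j))"
    using assms linear_functional_sum[OF a_linear[of "b j"], of "{..<n}" b x]
    by (simp add: orthonormal_def)
  also have "\<dots> = (\<Sum>i<n. if i = j then x i else 0)"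
    using assms by (intro sum.cong) (auto simp: orthonormal_def)
  finally show ?thesis using assms by simp
qed

lemma orthonormal_norm:
  assumes "orthonormal n b"
  shows "a (\<lambda>p. \<Sum>i<n. x i * b i p) (\<lambda>p. \<Sum>i<n. x i * b i p) = (\<Sum>i<n. (x i)\<^sup>2)"
proof -
  let ?s = "\<lambda>p. \<Sum>i<n. x i * b i p"
  have "?s \<in> V" using assms by (intro sum_mem) (auto simp: orthonormal_def)
  then have "a ?s ?s = (\<Sum>i<n. x i * a (b i) ?s)"
    using assms linear_functional_sum[OF a_linear[of ?s], of "{..<n}" b x]
    by (simp add: orthonormal_def)
  then show ?thesis
    using orthonormal_coefficient[OF assms, of _ x] by (simp add: a_sym[of "b _"] power2_eq_square)
qed

text \<open>With more members than functionals, some nontrivial combination would be annihilated by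
  all of them, although its \<open>a\<close>-square is the positive sum of the squares of its
  coefficients. This makes a family of maximal length available.\<close>

lemma orthonormal_length:
  assumes "orthonormal n b" "finite J"
    and "\<And>j. j \<in> J \<Longrightarrow> linear_functional (\<phi> j :: _ \<Rightarrow> real)"
    and "\<And>v. v \<in> V \<Longrightarrow> (\<forall>j\<in>J. \<phi> j v = 0) \<Longrightarrow> a v v = 0"
  shows "n \<le> card J"
proof (rule ccontr)
  assume "\<not> ?thesis"
  then obtain x where x: "\<exists>i<n. x i \<noteq> 0" "\<forall>j\<in>J. (\<Sum>i<n. \<phi> j (b i) * x i) = 0"
    using underdetermined_system[OF assms(2) finite_lessThan[of n], of "\<lambda>j i. \<phi> j (b i)"] by auto
  let ?s = "\<lambda>p. \<Sum>i<n. x i * b i p"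
  have b: "b i \<in> V" if "i < n" for i using assms(1) that by (simp add: orthonormal_def)
  have "\<phi> j ?s = 0" if "j \<in> J" for j
    using linear_functional_sum[OF assms(3)[OF that], of "{..<n}" b x] b x(2) that
    by (simp add: mult.commute)
  moreover have "?s \<in> V" using b by (intro sum_mem) auto
  ultimately have "(\<Sum>i<n. (x i)\<^sup>2) = 0"
    using assms(4)[of ?s] orthonormal_norm[OF assms(1), of x] by simp
  then show False using x(1) by (subst (asm) sum_nonneg_eq_0_iff) auto
qed

text \<open>An orthonormal family of maximal length spans \<open>V\<close> up to the kernel of \<open>a\<close>.\<close>

lemma orthonormal_spanning_family:
  assumes "finite J"
    and "\<And>j. j \<in> J \<Longrightarrow> linear_functional (\<phi> j :: _ \<Rightarrow> real)"
    and "\<And>v. v \<in> V \<Longrightarrow> (\<forall>j\<in>J. \<phi> j v = 0) \<Longrightarrow> a v v = 0"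
  obtains n b where "orthonormal n b"
    and "\<And>w. w \<in> V \<Longrightarrow> \<exists>r\<in>V. a r r = 0 \<and> w = (\<lambda>p. (\<Sum>i<n. a w (b i) * b i p) + r p)"
proof -
  have "\<exists>n. (\<exists>b. orthonormal n b) \<and> (\<forall>m. (\<exists>b. orthonormal m b) \<longrightarrow> m \<le> n)"
  proof (rule Nat.ex_has_greatest_nat)
    show "\<exists>b. orthonormal 0 b" by (simp add: orthonormal_def)
    show "\<forall>m. (\<exists>b. orthonormal m b) \<longrightarrow> m \<le> card J"
      using orthonormal_length assms by blast
  qed
  then obtain n b where on: "orthonormal n b" and max: "\<And>m b'. orthonormal m b' \<Longrightarrow> m \<le> n"
    by blast
  have b: "b i \<in> V" if "i < n" for i using on that by (simp add: orthonormal_def)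
  have "\<exists>r\<in>V. a r r = 0 \<and> w = (\<lambda>p. (\<Sum>i<n. a w (b i) * b i p) + r p)" if w: "w \<in> V" for w
  proof -
    let ?s = "\<lambda>p. \<Sum>i<n. a w (b i) * b i p"
    define r where "r = (\<lambda>p. 1 * w p + (- 1) * ?s p)"
    have s: "?s \<in> V" using b by (intro sum_mem) auto
    then have r: "r \<in> V" unfolding r_def using w by (intro comb)
    have perp: "a r (b j) = 0" if "j < n" for j
      using linear_functionalD[OF a_linear[OF b[OF that]] w s, of 1 "- 1"]
        orthonormal_coefficient[OF on that] unfolding r_def by simp
    have "a r r = 0"
    proof (rule ccontr)
      assume "a r r \<noteq> 0"
      then have pos: "a r r > 0" using a_nonneg[OF r] by simp
      \<comment> \<open>A residual of positive \<open>a\<close>-square, normalized, would prolong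
        the family of maximal length.\<close>
      define e where "e = (\<lambda>p. 1 / sqrt (a r r) * r p)"
      have e: "e \<in> V" unfolding e_def using r by (rule scale)
      have e1: "a e v = 1 / sqrt (a r r) * a r v" if "v \<in> V" for v
        using linear_functional_scale[OF a_linear[OF that] r, of "1 / sqrt (a r r)"]
        by (simp add: e_def)
      have "a e e = 1"
        using e1[OF e] e1[OF r] a_sym[of r e] pos by (simp add: field_simps)
      moreover have "a e (b j) = 0" if "j < n" for j
        using e1[OF b[OF that]] perp[OF that] by simp
      ultimately have "orthonormal (Suc n) (b(n := e))"
        using on e a_sym[of "b _" e] by (auto simp: orthonormal_def less_Suc_eq)
      then show False using max by fastforce
    qed
    moreover have "w = (\<lambda>p. ?s p + r p)" by (simp add: r_def)
    ultimately show ?thesis using r by blast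
  qed
  then show ?thesis using that on by blast
qed

text \<open>Testing with the members of a maximal orthonormal family gives a vector field in
  coordinates, and positivity of \<open>B v v\<close> where \<open>a v v = R\<^sup>2\<close> says
  that it points outwards. A zero solves the equation for these members; \<open>B_kernel\<close>
  covers the remaining part of a test function. \<open>B_cont\<close> is asked for all finite
  families because this one is chosen only in the proof.\<close>

lemma galerkin_solvability:
  assumes "finite J"
    and "\<And>j. j \<in> J \<Longrightarrow> linear_functional (\<phi> j :: _ \<Rightarrow> real)"
    and "\<And>v. v \<in> V \<Longrightarrow> (\<forall>j\<in>J. \<phi> j v = 0) \<Longrightarrow> a v v = 0"
    and B_linear: "\<And>u. u \<in> V \<Longrightarrow> linear_functional (B u :: _ \<Rightarrow> real)"
    and B_kernel: "\<And>u w. u \<in> V \<Longrightarrow> w \<in> V \<Longrightarrow> a w w = 0 \<Longrightarrow> B u w = 0"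
    and B_cont: "\<And>(n::nat) b w. (\<And>i. i < n \<Longrightarrow> b i \<in> V) \<Longrightarrow> w \<in> V \<Longrightarrow>
        continuous_on UNIV (\<lambda>x. B (\<lambda>p. \<Sum>i<n. x i * b i p) w)"
    and R: "R > 0"
    and B_pos: "\<And>v. v \<in> V \<Longrightarrow> a v v = R\<^sup>2 \<Longrightarrow> B v v > 0"
  shows "\<exists>u\<in>V. \<forall>w\<in>V. B u w = 0"
proof -
  obtain n b where on: "orthonormal n b"
    and span: "\<And>w. w \<in> V \<Longrightarrow> \<exists>r\<in>V. a r r = 0 \<and> w = (\<lambda>p. (\<Sum>i<n. a w (b i) * b i p) + r p)"
    using orthonormal_spanning_family[of J \<phi>, OF assms(1-3)] by blast
  have b: "b i \<in> V" if "i < n" for i using on that by (simp add: orthonormal_def)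
  define S where "S = (\<lambda>(x::nat \<Rightarrow> real) p. \<Sum>i<n. x i * b i p)"
  have S: "S x \<in> V" for x unfolding S_def using b by (intro sum_mem) auto
  have BS: "B u (S x) = (\<Sum>i<n. x i * B u (b i))" if "u \<in> V" for u x
    unfolding S_def using linear_functional_sum[OF B_linear[OF that], of "{..<n}" b x] b by simp
  have "\<exists>x. \<forall>i<n. B (S x) (b i) = 0"
  proof (rule zero_of_outward_field[OF _ R])
    show "continuous_on UNIV (\<lambda>x. B (S x) (b i))" if "i < n" for i
      unfolding S_def using B_cont[of n b "b i"] b that by blast
    show "(\<Sum>i<n. B (S x) (b i) * x i) > 0" if "(\<Sum>i<n. (x i)\<^sup>2) = R\<^sup>2" for x
      using B_pos[OF S, of x] orthonormal_norm[OF on, of x] BS[OF S, of x x] that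
      by (simp add: S_def mult.commute)
  qed
  then obtain x where x: "\<forall>i<n. B (S x) (b i) = 0" by blast
  have "B (S x) w = 0" if w: "w \<in> V" for w
  proof -
    obtain r where r: "r \<in> V" "a r r = 0" and w_eq: "w = (\<lambda>p. 1 * S (\<lambda>i. a w (b i)) p + 1 * r p)"
      using span[OF w] by (auto simp: S_def)
    have "B (S x) w = B (S x) (S (\<lambda>i. a w (b i))) + B (S x) r"
      by (subst w_eq, subst linear_functionalD[OF B_linear[OF S] S r(1)]) simp
    also have "\<dots> = 0" using x BS[OF S] B_kernel[OF S r] by simp
    finally show ?thesis .
  qed
  then show ?thesis using S by blast
qed

end

section \<open>Superposition operators on essentially bounded functions\<close>

text \<open>Unlike square integrability, essential boundedness survives composition with any
  continuous function, whatever the growth of the power with exponent \<delta>.\<close>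

definition ess_bounded :: "'x measure \<Rightarrow> ('x \<Rightarrow> 'b::euclidean_space) \<Rightarrow> bool" where
  "ess_bounded M v \<longleftrightarrow> v \<in> borel_measurable M \<and> (\<exists>R. AE x in M. norm (v x) \<le> R)"

lemma ess_bounded_measurable: "ess_bounded M v \<Longrightarrow> v \<in> borel_measurable M"
  by (simp add: ess_bounded_def)

lemma ess_boundedE:
  assumes "ess_bounded M v"
  obtains R where "AE x in M. norm (v x) \<le> R"
  using assms by (auto simp: ess_bounded_def)

lemma ess_bounded_const: "ess_bounded M (\<lambda>_. c)"
  by (auto simp: ess_bounded_def)

lemma ess_bounded_Pair:
  assumes "ess_bounded M u" "ess_bounded M v"
  shows "ess_bounded M (\<lambda>x. (u x, v x))"
proof -
  obtain R where "AE x in M. norm (u x) \<le> R" using ess_boundedE[OF assms(1)] .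
  moreover obtain S where "AE x in M. norm (v x) \<le> S" using ess_boundedE[OF assms(2)] .
  ultimately have "AE x in M. norm (u x, v x) \<le> R + S"
  proof eventually_elim
    case (elim x)
    then show ?case using norm_Pair_le[of "u x" "v x"] by linarith
  qed
  then show ?thesis
    using assms by (auto simp: ess_bounded_def intro!: borel_measurable_Pair)
qed

text \<open>A continuous \<open>E\<close> is bounded on the compact ball that contains almost all
  values of \<open>v\<close>.\<close>

lemma ess_bounded_compose:
  fixes E :: "'b::euclidean_space \<Rightarrow> 'c::euclidean_space"
  assumes "continuous_on UNIV E" "ess_bounded M v"
  shows "ess_bounded M (\<lambda>x. E (v x))"
proof -
  obtain R where R: "AE x in M. norm (v x) \<le> R" using ess_boundedE[OF assms(2)] .
  have "compact (E ` cball 0 R)"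
    using assms(1) by (intro compact_continuous_image) (auto intro: continuous_on_subset)
  then obtain L where "\<And>y. y \<in> cball 0 R \<Longrightarrow> norm (E y) \<le> L"
    using compact_imp_bounded bounded_iff by (metis imageI)
  then have "AE x in M. norm (E (v x)) \<le> L"
    using R by (auto elim: eventually_mono)
  moreover have "(\<lambda>x. E (v x)) \<in> borel_measurable M"
    using measurable_compose[OF ess_bounded_measurable[OF assms(2)] borel_measurable_continuous_onI[OF assms(1)]] .
  ultimately show ?thesis by (auto simp: ess_bounded_def)
qed

lemma ess_bounded_integrable:
  assumes "finite_measure M" "ess_bounded M v"
  shows "integrable M v"
proof -
  interpret finite_measure M by fact
  obtain R where "AE x in M. norm (v x) \<le> R" using ess_boundedE[OF assms(2)] .
  then show ?thesis
    using integrable_const_bound ess_bounded_measurable[OF assms(2)] by blast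
qed

text \<open>Dominated convergence along a sequence of coefficients: convergent coordinates are
  bounded, so the arguments of \<open>E\<close> stay almost everywhere in one ball, where
  \<open>E\<close> is bounded; constants are integrable as the measure is finite. The offset
  \<open>z0\<close> carries what does not depend on the coefficients.\<close>

lemma continuous_on_integral_superposition:
  fixes E :: "'b::euclidean_space \<Rightarrow> real" and z :: "nat \<Rightarrow> 'x \<Rightarrow> 'b"
  assumes "finite_measure M" and E: "continuous_on UNIV E"
    and z0: "ess_bounded M z0" and z: "\<And>i. i < n \<Longrightarrow> ess_bounded M (z i)"
  shows "continuous_on UNIV (\<lambda>x::nat \<Rightarrow> real. integral\<^sup>L M (\<lambda>p. E (z0 p + (\<Sum>i<n. x i *\<^sub>R z i p))))"
proof (rule continuous_on_sequentiallyI)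
  interpret finite_measure M by fact
  fix X :: "nat \<Rightarrow> nat \<Rightarrow> real" and x assume "X \<longlonglongrightarrow> x"
  then have lim: "(\<lambda>k. X k i) \<longlonglongrightarrow> x i" for i
    using continuous_on_tendsto_compose[OF continuous_on_product_coordinates[of i]] by simp
  then have "\<forall>i. \<exists>c. \<forall>k. \<bar>X k i\<bar> \<le> c"
    by (metis Bseq_def convergentI convergent_imp_Bseq real_norm_def)
  then obtain c where c: "\<And>i k. \<bar>X k i\<bar> \<le> c i" by metis
  obtain R0 where R0: "AE p in M. norm (z0 p) \<le> R0" using ess_boundedE[OF z0] .
  have "\<forall>i. \<exists>R. i < n \<longrightarrow> (AE p in M. norm (z i p) \<le> R)"
    using z by (auto simp: ess_bounded_def)
  then obtain r where r: "\<And>i. i < n \<Longrightarrow> AE p in M. norm (z i p) \<le> r i" by metis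
  define R where "R = R0 + (\<Sum>i<n. c i * r i)"
  have zr: "AE p in M. \<forall>i\<in>{..<n}. norm (z i p) \<le> r i"
    using r by (intro AE_finite_allI) auto
  have bnd: "AE p in M. norm (z0 p + (\<Sum>i<n. X k i *\<^sub>R z i p)) \<le> R" for k
    using R0 zr
  proof eventually_elim
    case (elim p)
    have "norm (\<Sum>i<n. X k i *\<^sub>R z i p) \<le> (\<Sum>i<n. c i * r i)"
    proof (rule sum_norm_le)
      show "norm (X k i *\<^sub>R z i p) \<le> c i * r i" if "i \<in> {..<n}" for i
        using elim that c[of k i] by (auto intro!: mult_mono intro: order_trans[OF abs_ge_zero])
    qed
    then show ?case unfolding R_def using elim norm_triangle_mono by blast
  qed
  have "compact (E ` cball 0 R)"
    using E by (intro compact_continuous_image) (auto intro: continuous_on_subset)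
  then obtain L where L: "\<And>y. y \<in> cball 0 R \<Longrightarrow> norm (E y) \<le> L"
    using compact_imp_bounded bounded_iff by (metis imageI)
  have meas: "(\<lambda>p. E (z0 p + (\<Sum>i<n. y i *\<^sub>R z i p))) \<in> borel_measurable M" for y
  proof -
    have "(\<lambda>p. z0 p + (\<Sum>i<n. y i *\<^sub>R z i p)) \<in> borel_measurable M"
      using z0 z
      by (intro borel_measurable_add borel_measurable_sum borel_measurable_scaleR borel_measurable_const
            ess_bounded_measurable) auto
    from measurable_compose[OF this borel_measurable_continuous_onI[OF E]] show ?thesis .
  qed
  show "(\<lambda>k. integral\<^sup>L M (\<lambda>p. E (z0 p + (\<Sum>i<n. X k i *\<^sub>R z i p))))
        \<longlonglongrightarrow> integral\<^sup>L M (\<lambda>p. E (z0 p + (\<Sum>i<n. x i *\<^sub>R z i p)))"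
  proof (rule integral_dominated_convergence[where w = "\<lambda>_. L"])
    show "AE p in M. (\<lambda>k. E (z0 p + (\<Sum>i<n. X k i *\<^sub>R z i p)))
                     \<longlonglongrightarrow> E (z0 p + (\<Sum>i<n. x i *\<^sub>R z i p))"
      by (intro AE_I2 continuous_on_tendsto_compose[OF E] tendsto_intros lim) auto
    show "AE p in M. norm (E (z0 p + (\<Sum>i<n. X k i *\<^sub>R z i p))) \<le> L" for k
      using bnd[of k] by eventually_elim (use L in simp)
  qed (use meas in auto)
qed

section \<open>The Crouzeix--Raviart space\<close>

lemma P1E:
  assumes "p \<in> P1"
  obtains c g where "p = (\<lambda>x. c + g \<bullet> x)"
  using assms unfolding P1_def by blast

lemma continuous_on_P1: "p \<in> P1 \<Longrightarrow> continuous_on S p"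
  by (elim P1E) (auto intro!: continuous_intros)

lemma P1_comb: "p \<in> P1 \<Longrightarrow> q \<in> P1 \<Longrightarrow> (\<lambda>x. c * p x + d * q x) \<in> P1"
proof -
  assume "p \<in> P1" "q \<in> P1"
  then obtain a g b h where "\<forall>x. p x = a + g \<bullet> x" "\<forall>x. q x = b + h \<bullet> x" by (auto simp: P1_def)
  then have "\<forall>x. c * p x + d * q x = (c * a + d * b) + (c *\<^sub>R g + d *\<^sub>R h) \<bullet> x"
    by (simp add: algebra_simps)
  then show ?thesis unfolding P1_def by blast
qed

lemma grad_affine: "grad (\<lambda>x. c + g \<bullet> x) x = g"
proof -
  have D: "GDERIV (\<lambda>x. c + g \<bullet> x) x :> g"
    unfolding gderiv_def by (auto intro!: derivative_eq_intros simp: inner_commute)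
  moreover have "D' = g" if "GDERIV (\<lambda>x. c + g \<bullet> x) x :> D'" for D'
  proof -
    have "(\<lambda>h. h \<bullet> D') = (\<lambda>h. h \<bullet> g)"
      using has_derivative_unique that D unfolding gderiv_def by blast
    then show ?thesis by (metis inner_commute vector_eq_ldot)
  qed
  ultimately show ?thesis unfolding grad_def by blast
qed

text \<open>Gradients of affine functions are constant, so the three evaluation points may
  differ.\<close>

lemma grad_P1_comb:
  assumes "p \<in> P1" "q \<in> P1"
  shows "grad (\<lambda>x. c * p x + d * q x) x = c *\<^sub>R grad p y + d *\<^sub>R grad q z"
proof -
  obtain a g b h where p: "p = (\<lambda>x. a + g \<bullet> x)" and q: "q = (\<lambda>x. b + h \<bullet> x)"
    using assms by (meson P1E)
  have "(\<lambda>x. c * p x + d * q x) = (\<lambda>x. (c * a + d * b) + (c *\<^sub>R g + d *\<^sub>R h) \<bullet> x)"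
    by (auto simp: p q algebra_simps)
  then show ?thesis by (simp add: grad_affine p q)
qed

text \<open>The set where two affine functions differ is open; inside the interior of
  \<open>K\<close> it is also null, hence empty. Agreement on a ball then forces equal slopes and
  constants.\<close>

lemma P1_eq_if_AE_eq:
  assumes "p \<in> P1" "q \<in> P1" "interior K \<noteq> {}" "K \<in> sets lebesgue"
    and "AE x in lebesgue_on K. p x = q x"
  shows "p = q"
proof -
  obtain a g b h where p: "p = (\<lambda>x. a + g \<bullet> x)" and q: "q = (\<lambda>x. b + h \<bullet> x)"
    using assms by (meson P1E)
  let ?U = "interior K \<inter> {x. p x \<noteq> q x}"
  have "open ?U"
    unfolding p q by (intro open_Int open_interior open_Collect_neq continuous_intros)
  moreover have "AE x in lebesgue. x \<notin> ?U"
    using assms(4,5) interior_subset[of K] by (auto simp: AE_restrict_space_iff elim!: eventually_mono)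
  ultimately have "negligible ?U"
    by (subst negligible_iff_null_sets, subst AE_iff_null_sets) auto
  then have eq: "p x = q x" if "x \<in> interior K" for x
    using \<open>open ?U\<close> open_not_negligible that by blast
  obtain x where "x \<in> interior K" using assms(3) by blast
  then obtain e where e: "e > 0" "ball x e \<subseteq> interior K"
    using open_contains_ball[of "interior K"] by auto
  have "g = h"
  proof (rule ccontr)
    assume "g \<noteq> h"
    \<comment> \<open>Scaled so that the step along \<open>g - h\<close> has length
      \<open>e / 2\<close> and stays in the ball.\<close>
    define t where "t = e / (2 * norm (g - h))"
    have "norm (t *\<^sub>R (g - h)) < e" using e \<open>g \<noteq> h\<close> by (simp add: t_def)
    then have "x + t *\<^sub>R (g - h) \<in> ball x e" by (simp add: dist_norm)
    moreover have "x \<in> ball x e" using e by simp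
    ultimately have "p (x + t *\<^sub>R (g - h)) = q (x + t *\<^sub>R (g - h))" "p x = q x"
      using e eq by blast+
    then have "t * ((g - h) \<bullet> (g - h)) = 0" by (simp add: p q algebra_simps)
    then show False using e \<open>g \<noteq> h\<close> by (simp add: t_def)
  qed
  moreover have "p x = q x" using \<open>x \<in> interior K\<close> by (rule eq)
  ultimately show ?thesis by (simp add: p q)
qed

text \<open>Uniqueness of the affine representative makes the definite description in
  \<open>cell_poly\<close> meaningful.\<close>

lemma cell_poly_eq:
  assumes "interior K \<noteq> {}" "K \<in> sets lebesgue" "p \<in> P1" "agrees_on v K p"
  shows "cell_poly v K = p"
  unfolding cell_poly_def
proof (rule the_equality)
  show "q = p" if "q \<in> P1 \<and> agrees_on v K q" for q
  proof (rule P1_eq_if_AE_eq)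
    have "AE x in lebesgue_on K. v x = q x" "AE x in lebesgue_on K. v x = p x"
      using that assms by (auto simp: agrees_on_def)
    then show "AE x in lebesgue_on K. q x = p x" by eventually_elim simp
  qed (use that assms in auto)
qed (use assms in auto)

text \<open>Three affinely independent points in the plane span a full-dimensional simplex.\<close>

lemma interior_triangle_nonempty:
  fixes a b c :: "real^2"
  assumes "\<not> collinear {a, b, c}"
  shows "interior (convex hull {a, b, c}) \<noteq> {}"
proof -
  have "card {a, b, c} = Suc DIM(real^2)" "\<not> affine_dependent {a, b, c}"
    using assms by (auto simp: collinear_3_eq_affine_dependent)
  then show ?thesis using interior_convex_hull_eq_empty by blast
qed

lemma mesh_cell:
  assumes "mesh \<sigma> \<Omega> \<T>" "K \<in> \<T>"
  shows "compact K" "interior K \<noteq> {}" "K \<in> sets lebesgue"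
proof -
  have K: "triangle K \<or> rectangle K" using assms by (auto simp: mesh_def)
  then show c: "compact K"
    by (auto simp: triangle_def rectangle_def intro!: finite_imp_compact_convex_hull)
  then show "K \<in> sets lebesgue" by (simp add: borel_compact)
  from K show "interior K \<noteq> {}"
  proof
    assume "rectangle K"
    then obtain a u w where *: "u \<noteq> 0" "w \<noteq> 0" "u \<bullet> w = 0"
      "K = convex hull {a, a + u, a + w, a + u + w}" by (auto simp: rectangle_def)
    \<comment> \<open>Collinearity would mean equality in the Cauchy-Schwarz inequality for
      \<open>u\<close> and \<open>w\<close>, which nonzero orthogonal vectors do not attain.\<close>
    have "\<not> collinear {a, a + u, a + w}"
    proof
      assume "collinear {a, a + u, a + w}"
      then have "collinear {a + u, a, a + w}" by (simp add: insert_commute)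
      then have "collinear {0, u, w}" using collinear_3[of "a + u" a "a + w"] by (simp add: NO_MATCH_def)
      then have "\<bar>u \<bullet> w\<bar> = norm u * norm w" by (simp add: norm_cauchy_schwarz_equal)
      then show False using * by simp
    qed
    then have "interior (convex hull {a, a + u, a + w}) \<noteq> {}"
      by (rule interior_triangle_nonempty)
    moreover have "convex hull {a, a + u, a + w} \<subseteq> K"
      unfolding * by (intro hull_mono) auto
    ultimately show ?thesis using interior_mono by blast
  qed (auto simp: triangle_def dest: interior_triangle_nonempty)
qed

lemma cell_poly_V_CR:
  assumes "mesh \<sigma> \<Omega> \<T>" "v \<in> V_CR \<Omega> \<T>" "K \<in> \<T>"
  shows "cell_poly v K \<in> P1" "agrees_on v K (cell_poly v K)"
proof -
  obtain p where "p \<in> P1" "agrees_on v K p"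
    using assms by (auto simp: V_CR_def)
  then show "cell_poly v K \<in> P1" "agrees_on v K (cell_poly v K)"
    using cell_poly_eq mesh_cell[OF assms(1,3)] by metis+
qed

lemma cell_poly_comb:
  assumes "mesh \<sigma> \<Omega> \<T>" "u \<in> V_CR \<Omega> \<T>" "v \<in> V_CR \<Omega> \<T>" "K \<in> \<T>"
  shows "cell_poly (\<lambda>x. c * u x + d * v x) K = (\<lambda>x. c * cell_poly u K x + d * cell_poly v K x)"
proof (rule cell_poly_eq)
  note u = cell_poly_V_CR[OF assms(1,2,4)] and v = cell_poly_V_CR[OF assms(1,3,4)]
  show "(\<lambda>x. c * cell_poly u K x + d * cell_poly v K x) \<in> P1"
    using u v by (intro P1_comb)
  have "AE x in lebesgue_on K. u x = cell_poly u K x" "AE x in lebesgue_on K. v x = cell_poly v K x"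
    using u v by (auto simp: agrees_on_def)
  then show "agrees_on (\<lambda>x. c * u x + d * v x) K (\<lambda>x. c * cell_poly u K x + d * cell_poly v K x)"
    unfolding agrees_on_def by eventually_elim simp
qed (use mesh_cell[OF assms(1,4)] in auto)

section \<open>Linear structure of the Crouzeix-Raviart space\<close>

lemma edge_integral_comb:
  assumes "continuous_on UNIV q" "continuous_on UNIV r"
  shows "edge_integral a b (\<lambda>x. c * q x + d * r x) = c * edge_integral a b q + d * edge_integral a b r"
proof -
  have i: "(\<lambda>t. k * s (linepath a b t)) integrable_on {0..1}" if "continuous_on UNIV s"
    for k and s :: "real^2 \<Rightarrow> real"
    by (intro integrable_continuous_interval continuous_intros continuous_on_compose2[OF that] continuous_on_linepath) auto
  then show ?thesis
    using assms by (simp add: edge_integral_def integral_add algebra_simps)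
qed

lemma L2_comb:
  assumes "u \<in> L2 \<Omega>" "v \<in> L2 \<Omega>"
  shows "(\<lambda>x. c * u x + d * v x) \<in> L2 \<Omega>"
proof -
  have [measurable]: "u \<in> borel_measurable (lebesgue_on \<Omega>)" "v \<in> borel_measurable (lebesgue_on \<Omega>)"
    and i: "integrable (lebesgue_on \<Omega>) (\<lambda>x. (u x)\<^sup>2)" "integrable (lebesgue_on \<Omega>) (\<lambda>x. (v x)\<^sup>2)"
    using assms by (auto simp: L2_def)
  have "integrable (lebesgue_on \<Omega>) (\<lambda>x. (c * u x + d * v x)\<^sup>2)"
  proof (rule Bochner_Integration.integrable_bound)
    show "integrable (lebesgue_on \<Omega>) (\<lambda>x. 2 * c\<^sup>2 * (u x)\<^sup>2 + 2 * d\<^sup>2 * (v x)\<^sup>2)"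
      using i by auto
    have "(c * s + d * t)\<^sup>2 \<le> 2 * c\<^sup>2 * s\<^sup>2 + 2 * d\<^sup>2 * t\<^sup>2" for s t
      using sum_squares_bound[of "c * s" "d * t"] by (simp add: power2_sum power_mult_distrib)
    then show "AE x in lebesgue_on \<Omega>. norm ((c * u x + d * v x)\<^sup>2)
        \<le> norm (2 * c\<^sup>2 * (u x)\<^sup>2 + 2 * d\<^sup>2 * (v x)\<^sup>2)"
      by (simp add: abs_of_nonneg)
  qed measurable
  then show ?thesis by (simp add: L2_def)
qed

lemma V_CR_interior_edge:
  "v \<in> V_CR \<Omega> \<T> \<Longrightarrow> (a, b, K, K') \<in> interior_edges \<T> \<Longrightarrow>
    edge_integral a b (\<lambda>x. cell_poly v K x - cell_poly v K' x) = 0"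
  unfolding V_CR_def by blast

lemma V_CR_boundary_edge:
  "v \<in> V_CR \<Omega> \<T> \<Longrightarrow> (a, b, K) \<in> boundary_edges \<Omega> \<T> \<Longrightarrow> edge_integral a b (cell_poly v K) = 0"
  unfolding V_CR_def by blast

text \<open>All edge conditions are linear in the cell polynomials, and these depend linearly on the
  function.\<close>

lemma V_CR_comb:
  assumes "mesh \<sigma> \<Omega> \<T>" and u: "u \<in> V_CR \<Omega> \<T>" and v: "v \<in> V_CR \<Omega> \<T>"
  shows "(\<lambda>x. c * u x + d * v x) \<in> V_CR \<Omega> \<T>"
proof -
  let ?w = "\<lambda>x. c * u x + d * v x"
  note cp = cell_poly_comb[OF assms]
  have cont: "continuous_on UNIV (cell_poly u K)" "continuous_on UNIV (cell_poly v K)" if "K \<in> \<T>" for K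
    using cell_poly_V_CR(1)[OF assms(1) _ that] u v continuous_on_P1 by blast+
  have "?w \<in> L2 \<Omega>" using u v by (intro L2_comb) (auto simp: V_CR_def)
  moreover have "\<exists>p\<in>P1. agrees_on ?w K p" if "K \<in> \<T>" for K
  proof (intro bexI)
    note 1 = cell_poly_V_CR[OF assms(1) u that] and 2 = cell_poly_V_CR[OF assms(1) v that]
    have "AE x in lebesgue_on K. u x = cell_poly u K x" "AE x in lebesgue_on K. v x = cell_poly v K x"
      using 1 2 by (auto simp: agrees_on_def)
    then show "agrees_on ?w K (\<lambda>x. c * cell_poly u K x + d * cell_poly v K x)"
      unfolding agrees_on_def by eventually_elim simp
    show "(\<lambda>x. c * cell_poly u K x + d * cell_poly v K x) \<in> P1"
      using 1 2 by (intro P1_comb)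
  qed
  moreover have "edge_integral a b (\<lambda>x. cell_poly ?w K x - cell_poly ?w K' x) = 0"
    if e: "(a, b, K, K') \<in> interior_edges \<T>" for a b K K'
  proof -
    have K: "K \<in> \<T>" "K' \<in> \<T>" using e by (auto simp: interior_edges_def)
    have "(\<lambda>x. cell_poly ?w K x - cell_poly ?w K' x)
        = (\<lambda>x. c * (cell_poly u K x - cell_poly u K' x) + d * (cell_poly v K x - cell_poly v K' x))"
      using K by (simp add: cp algebra_simps)
    then show ?thesis
      using V_CR_interior_edge[OF u e] V_CR_interior_edge[OF v e] K
      by (simp add: edge_integral_comb cont continuous_on_diff)
  qed
  moreover have "edge_integral a b (cell_poly ?w K) = 0"
    if e: "(a, b, K) \<in> boundary_edges \<Omega> \<T>" for a b K
  proof -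
    have "K \<in> \<T>" using e by (auto simp: boundary_edges_def)
    then show ?thesis
      using V_CR_boundary_edge[OF u e] V_CR_boundary_edge[OF v e]
      by (simp add: cp edge_integral_comb cont)
  qed
  ultimately show ?thesis by (auto simp: V_CR_def)
qed

lemma zero_V_CR:
  assumes "mesh \<sigma> \<Omega> \<T>"
  shows "(\<lambda>_. 0) \<in> V_CR \<Omega> \<T>"
proof -
  have z: "(\<lambda>_. 0) \<in> P1" unfolding P1_def by (auto intro!: exI[of _ 0])
  have "cell_poly (\<lambda>_. 0) K = (\<lambda>_. 0)" if "K \<in> \<T>" for K
    using mesh_cell[OF assms that] z by (intro cell_poly_eq) (auto simp: agrees_on_def)
  moreover have "\<exists>p\<in>P1. agrees_on (\<lambda>_. 0) K p" for K
    using z by (intro bexI[of _ "\<lambda>_. 0"]) (simp_all add: agrees_on_def)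
  ultimately show ?thesis
    unfolding V_CR_def L2_def edge_integral_def interior_edges_def boundary_edges_def by simp
qed

text \<open>Almost everywhere on a cell \<open>v\<close> is affine, hence bounded by compactness;
  finitely many cells cover \<Omega>.\<close>

lemma V_CR_ess_bounded:
  assumes mesh: "mesh \<sigma> \<Omega> \<T>" and "open \<Omega>" and v: "v \<in> V_CR \<Omega> \<T>"
  shows "ess_bounded (lebesgue_on \<Omega>) v"
proof -
  have fin: "finite \<T>" and cover: "\<Omega> \<subseteq> \<Union>\<T>"
    using mesh closure_subset[of \<Omega>] by (auto simp: mesh_def)
  have "\<exists>M. AE x in lebesgue. x \<in> K \<longrightarrow> \<bar>v x\<bar> \<le> M" if "K \<in> \<T>" for K
  proof -
    note cell = mesh_cell[OF mesh that] and p = cell_poly_V_CR[OF mesh v that]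
    have "compact (cell_poly v K ` K)"
      using cell p by (intro compact_continuous_image continuous_on_P1)
    then obtain M where "\<And>x. x \<in> K \<Longrightarrow> \<bar>cell_poly v K x\<bar> \<le> M"
      using compact_imp_bounded bounded_iff by (metis imageI real_norm_def)
    moreover have "AE x in lebesgue. x \<in> K \<longrightarrow> v x = cell_poly v K x"
      using p cell by (simp add: agrees_on_def AE_restrict_space_iff)
    ultimately have "AE x in lebesgue. x \<in> K \<longrightarrow> \<bar>v x\<bar> \<le> M"
      by (auto elim!: eventually_mono)
    then show ?thesis ..
  qed
  then obtain M where "\<And>K. K \<in> \<T> \<Longrightarrow> AE x in lebesgue. x \<in> K \<longrightarrow> \<bar>v x\<bar> \<le> M K" by metis
  then have "AE x in lebesgue. \<forall>K\<in>\<T>. x \<in> K \<longrightarrow> \<bar>v x\<bar> \<le> M K"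
    by (intro AE_finite_allI fin)
  then have "AE x in lebesgue. x \<in> \<Omega> \<longrightarrow> \<bar>v x\<bar> \<le> (\<Sum>K\<in>\<T>. \<bar>M K\<bar>)"
  proof eventually_elim
    case (elim x)
    show ?case
    proof
      assume "x \<in> \<Omega>"
      then obtain K where "K \<in> \<T>" "x \<in> K" using cover by blast
      then have "\<bar>v x\<bar> \<le> \<bar>M K\<bar>" using elim by fastforce
      also have "\<dots> \<le> (\<Sum>K\<in>\<T>. \<bar>M K\<bar>)" using fin \<open>K \<in> \<T>\<close> by (intro member_le_sum) auto
      finally show "\<bar>v x\<bar> \<le> (\<Sum>K\<in>\<T>. \<bar>M K\<bar>)" .
    qed
  qed
  then have "AE x in lebesgue_on \<Omega>. norm (v x) \<le> (\<Sum>K\<in>\<T>. \<bar>M K\<bar>)"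
    using \<open>open \<Omega>\<close> by (simp add: AE_restrict_space_iff)
  moreover have "v \<in> borel_measurable (lebesgue_on \<Omega>)"
    using v by (simp add: V_CR_def L2_def)
  ultimately show ?thesis by (auto simp: ess_bounded_def)
qed

lemma grad_P1_const: "p \<in> P1 \<Longrightarrow> grad p x = grad p y"
  by (elim P1E) (simp add: grad_affine)

lemma grad_h_comb:
  assumes "mesh \<sigma> \<Omega> \<T>" "u \<in> V_CR \<Omega> \<T>" "v \<in> V_CR \<Omega> \<T>"
  shows "grad_h \<T> (\<lambda>x. c * u x + d * v x) x = c *\<^sub>R grad_h \<T> u x + d *\<^sub>R grad_h \<T> v x"
proof -
  have "grad (cell_poly (\<lambda>x. c * u x + d * v x) K) x
      = c *\<^sub>R grad (cell_poly u K) x + d *\<^sub>R grad (cell_poly v K) x" if "K \<in> \<T>" for K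
    using cell_poly_V_CR(1)[OF assms(1) _ that] assms that
    by (simp add: cell_poly_comb grad_P1_comb)
  then show ?thesis
    unfolding grad_h_def by (simp add: scaleR_right_distrib sum.distrib scaleR_sum_right mult.commute)
qed

lemma grad_h_ess_bounded:
  assumes mesh: "mesh \<sigma> \<Omega> \<T>" and v: "v \<in> V_CR \<Omega> \<T>"
  shows "ess_bounded (lebesgue_on S) (grad_h \<T> v)"
proof -
  \<comment> \<open>Evaluating the constant gradients at 0 instead of \<open>x\<close> exhibits
    \<open>grad_h\<close> as a finite combination of indicators of open sets with constant
    vectors.\<close>
  have eq: "grad_h \<T> v = (\<lambda>x. \<Sum>K\<in>\<T>. indicat_real (interior K) x *\<^sub>R grad (cell_poly v K) 0)"
    unfolding grad_h_def using grad_P1_const[OF cell_poly_V_CR(1)[OF mesh v]]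
    by (intro ext sum.cong refl) metis
  have "grad_h \<T> v \<in> borel_measurable borel" unfolding eq
    by (intro borel_measurable_sum borel_measurable_scaleR borel_measurable_indicator) auto
  then have "grad_h \<T> v \<in> borel_measurable lebesgue"
    by (intro measurable_completion) simp
  moreover have "norm (grad_h \<T> v x) \<le> (\<Sum>K\<in>\<T>. norm (grad (cell_poly v K) 0))" for x
    unfolding eq by (rule sum_norm_le) (simp add: indicator_def)
  ultimately show ?thesis
    by (auto simp: ess_bounded_def intro!: measurable_restrict_space1)
qed

section \<open>The discrete problem\<close>

text \<open>An exponent of at least 1 turns the integer case into a natural power and makes
  \<open>powr\<close> continuous also at the base 0.\<close>

lemma continuous_on_gpow:
  assumes "\<delta> \<ge> 1"
  shows "continuous_on S (\<lambda>s. gpow s \<delta>)"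
proof (cases "\<delta> \<in> \<int>")
  case True
  moreover have "0 \<le> \<lfloor>\<delta>\<rfloor>" using assms by simp
  ultimately have "gpow s \<delta> = s ^ nat \<lfloor>\<delta>\<rfloor>" for s
    by (simp add: gpow_def power_int_def)
  then show ?thesis by (simp only:) (intro continuous_intros)
next
  case False
  then show ?thesis
    using assms unfolding gpow_def
    by (simp, intro continuous_on_powr' continuous_on_rabs continuous_on_id continuous_on_const) auto
qed

text \<open>The four arguments stand for the values at a point of \<open>v\<close>, its gradient,
  \<open>w\<close> and its gradient. As one continuous function of a Euclidean variable, the
  integrand fits the superposition results.\<close>

definition nc_integrand ::
    "real \<Rightarrow> real \<Rightarrow> real \<Rightarrow> real \<Rightarrow> real \<Rightarrow> real \<times> (real^2) \<times> real \<times> (real^2) \<Rightarrow> real" where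
  "nc_integrand \<nu> \<alpha> \<beta> \<gamma> \<delta> = (\<lambda>(s, t, s', t').
     \<nu> * (t \<bullet> t') + \<alpha> * (gpow s \<delta> * (t $ 1 + t $ 2) * s')
     - \<beta> * (s * (1 - gpow s \<delta>) * (gpow s \<delta> - \<gamma>) * s'))"

lemma const_vec_inner: "(\<chi> i. c) \<bullet> (t::real^2) = c * (t $ 1 + t $ 2)"
  by (simp add: inner_vec_def sum_2 algebra_simps)

lemma continuous_on_gpow_compose:
  assumes "\<delta> \<ge> 1" "continuous_on S h"
  shows "continuous_on S (\<lambda>x. gpow (h x) \<delta>)"
  using continuous_on_compose2[OF continuous_on_gpow[OF assms(1), of UNIV] assms(2)] by simp

lemma continuous_on_nc_integrand: "\<delta> \<ge> 1 \<Longrightarrow> continuous_on UNIV (nc_integrand \<nu> \<alpha> \<beta> \<gamma> \<delta>)"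
  unfolding nc_integrand_def case_prod_beta
  by (intro continuous_intros continuous_on_gpow_compose)

text \<open>Essential boundedness makes each of the three integrands integrable, so that the
  integrals may be merged into one.\<close>

lemma A_NC_eq_integral:
  assumes fin: "finite_measure (lebesgue_on \<Omega>)" and "\<delta> \<ge> 1"
    and z: "ess_bounded (lebesgue_on \<Omega>) (\<lambda>x. (v x, grad_h \<T> v x, w x, grad_h \<T> w x))"
  shows "A_NC \<Omega> \<T> \<nu> \<alpha> \<beta> \<gamma> \<delta> v w = integral\<^sup>L (lebesgue_on \<Omega>)
           (\<lambda>x. nc_integrand \<nu> \<alpha> \<beta> \<gamma> \<delta> (v x, grad_h \<T> v x, w x, grad_h \<T> w x))"
proof -
  let ?M = "lebesgue_on \<Omega>" and ?z = "\<lambda>x. (v x, grad_h \<T> v x, w x, grad_h \<T> w x)"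
  have int: "integrable ?M (\<lambda>x. E (?z x))" if "continuous_on UNIV E"
    for E :: "real \<times> (real^2) \<times> real \<times> (real^2) \<Rightarrow> real"
    using ess_bounded_integrable[OF fin ess_bounded_compose[OF that z]] .
  have "integrable ?M (\<lambda>x. grad_h \<T> v x \<bullet> grad_h \<T> w x)"
    using int[of "\<lambda>y. fst (snd y) \<bullet> snd (snd (snd y))"]
    by (simp add: continuous_intros)
  moreover have "integrable ?M (\<lambda>x. gpow (v x) \<delta> * (grad_h \<T> v x $ 1 + grad_h \<T> v x $ 2) * w x)"
    using int[of "\<lambda>y. gpow (fst y) \<delta> * (fst (snd y) $ 1 + fst (snd y) $ 2) * fst (snd (snd y))"]
      \<open>\<delta> \<ge> 1\<close> by (simp add: continuous_intros continuous_on_gpow_compose)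
  moreover have "integrable ?M (\<lambda>x. v x * (1 - gpow (v x) \<delta>) * (gpow (v x) \<delta> - \<gamma>) * w x)"
    using int[of "\<lambda>y. fst y * (1 - gpow (fst y) \<delta>) * (gpow (fst y) \<delta> - \<gamma>) * fst (snd (snd y))"]
      \<open>\<delta> \<ge> 1\<close> by (simp add: continuous_intros continuous_on_gpow_compose)
  ultimately show ?thesis
    unfolding A_NC_def L2_inner_def nc_integrand_def const_vec_inner by simp
qed

text \<open>AM-GM gives \<open>\<bar>\<alpha> s g (t\<^sub>1 + t\<^sub>2)\<bar> \<le> \<beta>/2 (s g)\<^sup>2 + \<alpha>\<^sup>2/\<beta> \<bar>t\<bar>\<^sup>2\<close> and
  \<open>\<beta> (1 + \<gamma>) s\<^sup>2 g \<le> \<beta>/2 (s g)\<^sup>2 + \<beta>/2 (1 + \<gamma>)\<^sup>2 s\<^sup>2\<close> for \<open>g = s\<^sup>\<delta>\<close>; the two terms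
  \<open>\<beta>/2 (s g)\<^sup>2\<close> are absorbed by the leading part of the reaction term.\<close>

lemma nc_integrand_coercive:
  assumes "\<beta> > 0"
  shows "nc_integrand \<nu> \<alpha> \<beta> \<gamma> \<delta> (s, t, s, t)
           \<ge> (\<nu> - \<alpha>\<^sup>2 / \<beta>) * (t \<bullet> t) - \<beta> * (1 + \<gamma>\<^sup>2) / 2 * s\<^sup>2"
proof -
  define g where "g = gpow s \<delta>"
  define q where "q = t $ 1 + t $ 2"
  define X where "X = \<beta> * (s * g)\<^sup>2"
  define Y where "Y = \<beta> * (1 + \<gamma>) * s\<^sup>2 * g"
  define Z where "Z = \<alpha> * (g * q * s)"
  define Q where "Q = \<alpha>\<^sup>2 / \<beta> * q\<^sup>2"
  define W where "W = \<alpha>\<^sup>2 / \<beta> * (t \<bullet> t)"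
  have tt: "t \<bullet> t = (t $ 1)\<^sup>2 + (t $ 2)\<^sup>2"
    by (simp add: inner_vec_def sum_2 power2_eq_square)
  have "q\<^sup>2 \<le> 2 * (t \<bullet> t)"
    using sum_squares_bound[of "t $ 1" "t $ 2"] by (simp add: q_def tt power2_sum)
  then have "Q \<le> \<alpha>\<^sup>2 / \<beta> * (2 * (t \<bullet> t))"
    unfolding Q_def using assms by (intro mult_left_mono) auto
  also have "\<dots> = 2 * W" by (simp add: W_def)
  finally have q_le: "Q \<le> 2 * W" .
  have "0 \<le> (\<beta> * (s * g) + \<alpha> * q)\<^sup>2 / (2 * \<beta>)"
    using assms by simp
  also have "\<dots> = X / 2 + Z + Q / 2"
    using assms by (simp add: X_def Z_def Q_def power2_eq_square field_simps)
  finally have convection: "0 \<le> X / 2 + Z + W" using q_le by linarith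
  have "0 \<le> \<beta> / 2 * (s * g - (1 + \<gamma>) * s)\<^sup>2"
    using assms by simp
  \<comment> \<open>The cross term of \<open>(1 + \<gamma>)\<^sup>2\<close> is exactly the term
    \<open>\<beta> * \<gamma> * s\<^sup>2\<close> already present in the reaction part, so only
    \<open>1 + \<gamma>\<^sup>2\<close> survives in the final bound.\<close>
  also have "\<dots> = X / 2 - Y + \<beta> * \<gamma> * s\<^sup>2 + \<beta> * (1 + \<gamma>\<^sup>2) / 2 * s\<^sup>2"
    by (simp add: X_def Y_def power2_eq_square field_simps)
  finally have reaction: "0 \<le> X / 2 - Y + \<beta> * \<gamma> * s\<^sup>2 + \<beta> * (1 + \<gamma>\<^sup>2) / 2 * s\<^sup>2" .
  have "nc_integrand \<nu> \<alpha> \<beta> \<gamma> \<delta> (s, t, s, t) = \<nu> * (t \<bullet> t) + Z + X - Y + \<beta> * \<gamma> * s\<^sup>2"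
    by (simp add: nc_integrand_def g_def q_def X_def Y_def Z_def power2_eq_square algebra_simps)
  moreover have "(\<nu> - \<alpha>\<^sup>2 / \<beta>) * (t \<bullet> t) = \<nu> * (t \<bullet> t) - W"
    by (simp add: W_def left_diff_distrib)
  ultimately show ?thesis using convection reaction by linarith
qed

lemma L2_norm_square: "(L2_norm \<Omega> g)\<^sup>2 = L2_inner \<Omega> g g"
  by (simp add: L2_norm_def L2_inner_def)

theorem theorem3p4:
  fixes \<Omega> :: "(real^2) set" and \<T> :: "(real^2) set set"
    and \<sigma> \<nu> \<alpha> \<beta> \<gamma> \<delta> C k :: real
    and f :: "real^2 \<Rightarrow> real"
  assumes "open \<Omega>" "bounded \<Omega>" "\<Omega> \<noteq> {}" "simply_connected \<Omega>" "lipschitz_boundary \<Omega>"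
    and "mesh \<sigma> \<Omega> \<T>"
    and "\<nu> > 0" "\<alpha> > 0" "\<beta> > 0" "\<delta> \<ge> 1" "0 < \<gamma>" "\<gamma> < 1"
    and "f \<in> L2 \<Omega>"
    and "C > 0"
    and "\<And>v. v \<in> V_CR \<Omega> \<T> \<Longrightarrow> (L2_norm \<Omega> v)\<^sup>2 \<le> C * (L2_norm \<Omega> (grad_h \<T> v))\<^sup>2"
    and "\<nu> + \<beta> * \<gamma> * C > \<beta> * (1 + \<gamma>)\<^sup>2 * C + 2 * \<alpha>\<^sup>2 / \<beta>"
    and "k > C / (\<nu> * sqrt (\<nu> + \<beta> * \<gamma> * C - \<beta> * (1 + \<gamma>)\<^sup>2 * C - 2 * \<alpha>\<^sup>2 / \<beta>)) * L2_norm \<Omega> f"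
  shows "\<exists>u\<in>V_CR \<Omega> \<T>. \<forall>w\<in>V_CR \<Omega> \<T>. A_NC \<Omega> \<T> \<nu> \<alpha> \<beta> \<gamma> \<delta> u w = L2_inner \<Omega> f w"
proof -

  \<comment> \<open>Integral representation of the discrete problem\<close>
  note mesh = \<open>mesh \<sigma> \<Omega> \<T>\<close>
  let ?V = "V_CR \<Omega> \<T>"
  define M where "M = lebesgue_on \<Omega>"
  define D where "D = grad_h \<T>"
  define E where "E = nc_integrand \<nu> \<alpha> \<beta> \<gamma> \<delta>"
  define a where "a = (\<lambda>v w. L2_inner \<Omega> (D v) (D w))"
  \<comment> \<open>Solutions are the \<open>u\<close> for which the residual \<open>B u\<close>
    vanishes on the discrete space.\<close>
  define B where "B = (\<lambda>v w. A_NC \<Omega> \<T> \<nu> \<alpha> \<beta> \<gamma> \<delta> v w - L2_inner \<Omega> f w)"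
  have "finite \<T>" using mesh by (simp add: mesh_def)
  have fin: "finite_measure M"
    unfolding M_def using \<open>open \<Omega>\<close> \<open>bounded \<Omega>\<close>
    by (intro finite_measure_lebesgue_on lmeasurable_open)
  have vb: "ess_bounded M v" and Db: "ess_bounded M (D v)" if "v \<in> ?V" for v
    unfolding M_def D_def
    using V_CR_ess_bounded[OF mesh \<open>open \<Omega>\<close> that] grad_h_ess_bounded[OF mesh that] by auto
  have D_comb: "D (\<lambda>x. c * u x + d * v x) = (\<lambda>x. c *\<^sub>R D u x + d *\<^sub>R D v x)"
    if "u \<in> ?V" "v \<in> ?V" for c d u v
    unfolding D_def using grad_h_comb[OF mesh that] by auto
  have D_inner: "integrable M (\<lambda>x. D v x \<bullet> D w x)" if "v \<in> ?V" "w \<in> ?V" for v w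
    using ess_bounded_integrable[OF fin ess_bounded_compose[OF _ ess_bounded_Pair[OF Db Db]],
        of "\<lambda>y. fst y \<bullet> snd y" v w] that
    by (simp add: continuous_intros)
  have a_eq: "a v w = integral\<^sup>L M (\<lambda>x. D v x \<bullet> D w x)" for v w
    by (simp add: a_def L2_inner_def M_def)
  have zb: "ess_bounded M (\<lambda>x. (v x, D v x, w x, D w x))" if "v \<in> ?V" "w \<in> ?V" for v w
    using that by (intro ess_bounded_Pair vb Db)
  have E_cont: "continuous_on UNIV E"
    unfolding E_def using \<open>\<delta> \<ge> 1\<close> by (rule continuous_on_nc_integrand)
  have E_int: "integrable M (\<lambda>x. E (v x, D v x, w x, D w x))" if "v \<in> ?V" "w \<in> ?V" for v w
    using ess_bounded_integrable[OF fin ess_bounded_compose[OF E_cont zb[OF that]]] .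
  have v2_int: "integrable M (\<lambda>x. (v x)\<^sup>2)" if "v \<in> ?V" for v
    using that by (simp add: V_CR_def L2_def M_def)
  have f2_int: "integrable M (\<lambda>x. (f x)\<^sup>2)" and f_meas: "f \<in> borel_measurable M"
    using \<open>f \<in> L2 \<Omega>\<close> by (auto simp: L2_def M_def)
  have fv_int: "integrable M (\<lambda>x. f x * v x)" if "v \<in> ?V" for v
  proof (rule Bochner_Integration.integrable_bound)
    show "integrable M (\<lambda>x. (f x)\<^sup>2 + (v x)\<^sup>2)"
      using f2_int v2_int[OF that] by simp
    show "(\<lambda>x. f x * v x) \<in> borel_measurable M"
      using f_meas ess_bounded_measurable[OF vb[OF that]] by simp
    have "\<bar>p * q\<bar> \<le> p\<^sup>2 + q\<^sup>2" for p q :: real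
      using sum_squares_bound[of "\<bar>p\<bar>" "\<bar>q\<bar>"] mult_nonneg_nonneg[of "\<bar>p\<bar>" "\<bar>q\<bar>"]
      unfolding abs_mult power2_abs by linarith
    then show "AE x in M. norm (f x * v x) \<le> norm ((f x)\<^sup>2 + (v x)\<^sup>2)"
      by simp
  qed
  have B_eq: "B v w = integral\<^sup>L M (\<lambda>x. E (v x, D v x, w x, D w x)) - integral\<^sup>L M (\<lambda>x. f x * w x)"
    if "v \<in> ?V" "w \<in> ?V" for v w
    using A_NC_eq_integral[OF fin[unfolded M_def] \<open>\<delta> \<ge> 1\<close> zb[OF that, unfolded M_def D_def]]
    by (simp add: B_def E_def M_def D_def L2_inner_def)
  have poincare: "integral\<^sup>L M (\<lambda>x. (v x)\<^sup>2) \<le> C * a v v" if "v \<in> ?V" for v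
    using assms(15)[OF that]
    by (simp add: L2_norm_square a_def D_def) (simp add: L2_inner_def M_def power2_eq_square)
  interpret function_subspace ?V
    using zero_V_CR[OF mesh] V_CR_comb[OF mesh] by unfold_locales
  interpret psd_form ?V a
  proof
    show "linear_functional (\<lambda>v. a v w)" if "w \<in> ?V" for w
      unfolding linear_functional_def a_eq
      using that by (simp add: D_comb D_inner inner_add_left)
    show "a v w = a w v" for v w by (simp add: a_eq inner_commute)
    show "a v v \<ge> 0" for v by (simp add: a_eq)
  qed
  \<comment> \<open>At fixed first two arguments \<open>E\<close> is linear in the last two, which
    yields linearity of \<open>B\<close> in the test function.\<close>
  have E_comb: "E (s, t, c * p + d * q, c *\<^sub>R y + d *\<^sub>R z) = c * E (s, t, p, y) + d * E (s, t, q, z)"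
    for s t c d p q y z
    by (simp add: E_def nc_integrand_def inner_add_right algebra_simps)

  \<comment> \<open>Coercivity of the discrete form\<close>
  define m where "m = \<nu> - \<alpha>\<^sup>2 / \<beta> - \<beta> * C * (1 + \<gamma>\<^sup>2) / 2"
  have "m > 0"
  proof -
    \<comment> \<open>Since \<open>(1 + \<gamma>)\<^sup>2 - \<gamma>\<close> is the mean of
      \<open>1 + \<gamma>\<^sup>2\<close> and \<open>(1 + \<gamma>)\<^sup>2\<close>, the assumed
      inequality makes \<open>m\<close> exceed the sum of the two nonnegative terms here.\<close>
    have "0 \<le> \<beta> * C * (1 + \<gamma> * 2 + \<gamma>\<^sup>2) / 2" "0 \<le> \<alpha>\<^sup>2 / \<beta>"
      using \<open>\<beta> > 0\<close> \<open>C > 0\<close> \<open>0 < \<gamma>\<close> by simp_all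
    moreover have "\<beta> * (1 + \<gamma>)\<^sup>2 * C - \<beta> * \<gamma> * C
        = \<beta> * C * (1 + \<gamma>\<^sup>2) / 2 + \<beta> * C * (1 + \<gamma> * 2 + \<gamma>\<^sup>2) / 2"
      by (simp add: power2_eq_square field_simps)
    ultimately show ?thesis using assms(16) by (simp add: m_def)
  qed
  define F where "F = integral\<^sup>L M (\<lambda>x. (f x)\<^sup>2)"
  have "F \<ge> 0" by (simp add: F_def)
  \<comment> \<open>Young's inequality for \<open>f x * v x\<close> is weighted with
    \<open>m / (2 * C)\<close> so that, by Poincare-Friedrichs, the load uses up half of the
    coercivity constant \<open>m\<close>.\<close>
  have lower: "B v v \<ge> m / 2 * a v v - C / (2 * m) * F" if v: "v \<in> ?V" for v
  proof -
    have "integral\<^sup>L M (\<lambda>x. (\<nu> - \<alpha>\<^sup>2 / \<beta>) * (D v x \<bullet> D v x) - \<beta> * (1 + \<gamma>\<^sup>2) / 2 * (v x)\<^sup>2)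
        \<le> integral\<^sup>L M (\<lambda>x. E (v x, D v x, v x, D v x))"
      unfolding E_def using E_int[OF v v] D_inner[OF v v] v2_int[OF v] \<open>\<beta> > 0\<close>
      by (intro integral_mono nc_integrand_coercive) (auto simp: E_def)
    moreover have "integral\<^sup>L M (\<lambda>x. f x * v x)
        \<le> integral\<^sup>L M (\<lambda>x. C / (2 * m) * (f x)\<^sup>2 + m / (2 * C) * (v x)\<^sup>2)"
    proof (rule integral_mono)
      show "f x * v x \<le> C / (2 * m) * (f x)\<^sup>2 + m / (2 * C) * (v x)\<^sup>2" for x
      proof -
        have "0 \<le> (C * f x - m * v x)\<^sup>2 / (2 * m * C)"
          using \<open>m > 0\<close> \<open>C > 0\<close> by simp
        also have "\<dots> = C / (2 * m) * (f x)\<^sup>2 + m / (2 * C) * (v x)\<^sup>2 - f x * v x"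
          using \<open>m > 0\<close> \<open>C > 0\<close> by (simp add: power2_eq_square field_simps)
        finally show ?thesis by simp
      qed
    qed (use fv_int[OF v] f2_int v2_int[OF v] in auto)
    ultimately have "B v v \<ge> (\<nu> - \<alpha>\<^sup>2 / \<beta>) * a v v
        - (\<beta> * (1 + \<gamma>\<^sup>2) / 2 + m / (2 * C)) * integral\<^sup>L M (\<lambda>x. (v x)\<^sup>2) - C / (2 * m) * F"
      using D_inner[OF v v] v2_int[OF v] f2_int
      by (simp add: B_eq[OF v v] a_eq F_def algebra_simps)
    moreover have "(\<beta> * (1 + \<gamma>\<^sup>2) / 2 + m / (2 * C)) * integral\<^sup>L M (\<lambda>x. (v x)\<^sup>2)
        \<le> (\<beta> * (1 + \<gamma>\<^sup>2) / 2 + m / (2 * C)) * (C * a v v)"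
      using \<open>m > 0\<close> \<open>C > 0\<close> \<open>\<beta> > 0\<close> by (intro mult_left_mono poincare v) auto
    moreover have "(\<nu> - \<alpha>\<^sup>2 / \<beta>) * a v v - (\<beta> * (1 + \<gamma>\<^sup>2) / 2 + m / (2 * C)) * (C * a v v)
        = m / 2 * a v v"
    proof -
      have "(\<beta> * (1 + \<gamma>\<^sup>2) / 2 + m / (2 * C)) * C = \<beta> * C * (1 + \<gamma>\<^sup>2) / 2 + m / 2"
        using \<open>C > 0\<close> by (simp add: field_simps)
      also have "\<dots> = (\<nu> - \<alpha>\<^sup>2 / \<beta>) - m / 2" by (simp add: m_def field_simps)
      finally show ?thesis by (simp add: mult.assoc[symmetric] left_diff_distrib)
    qed
    ultimately show ?thesis by linarith
  qed
  \<comment> \<open>Chosen so that the lower bound equals 1 on the sphere; the summand 1 also keeps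
    \<open>R\<close> positive when \<open>F = 0\<close>.\<close>
  define R where "R = sqrt (2 / m * (C / (2 * m) * F + 1))"
  have "C / (2 * m) * F \<ge> 0" using \<open>m > 0\<close> \<open>C > 0\<close> \<open>F \<ge> 0\<close> by simp
  then have "2 / m * (C / (2 * m) * F + 1) > 0" using \<open>m > 0\<close> by (intro mult_pos_pos) auto
  then have R: "R > 0" "R\<^sup>2 = 2 / m * (C / (2 * m) * F + 1)" by (simp_all add: R_def)

  \<comment> \<open>Verification of the Galerkin hypotheses\<close>
  have "\<exists>u\<in>?V. \<forall>w\<in>?V. B u w = 0"
  proof (rule galerkin_solvability)
    \<comment> \<open>The gradient components on the cells, constant and therefore read off at the
      origin, are finitely many functionals whose common zeros have vanishing piecewise
      gradient.\<close>
    let ?\<phi> = "\<lambda>(K, i) v. grad (cell_poly v K) 0 $ i"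
    show "finite (\<T> \<times> (UNIV :: 2 set))" using \<open>finite \<T>\<close> by simp
    show "linear_functional (?\<phi> j)" if J: "j \<in> \<T> \<times> UNIV" for j
    proof -
      obtain K i where j: "j = (K, i)" "K \<in> \<T>" using J by auto
      show ?thesis
        unfolding linear_functional_def j using cell_poly_V_CR(1)[OF mesh _ j(2)]
        by (simp add: cell_poly_comb[OF mesh _ _ j(2)] grad_P1_comb[where y = 0 and z = 0])
    qed
    show "a v v = 0" if "v \<in> ?V" "\<forall>j\<in>\<T> \<times> UNIV. ?\<phi> j v = 0" for v
    proof -
      have "grad (cell_poly v K) x = 0" if "K \<in> \<T>" for K x
        using \<open>\<forall>j\<in>\<T> \<times> UNIV. ?\<phi> j v = 0\<close> that
          grad_P1_const[OF cell_poly_V_CR(1)[OF mesh \<open>v \<in> ?V\<close> that], of x 0]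
        by (simp add: vec_eq_iff)
      then have "D v x = 0" for x by (simp add: D_def grad_h_def)
      then show ?thesis by (simp add: a_eq)
    qed
    show "linear_functional (B u)" if u: "u \<in> ?V" for u
      unfolding linear_functional_def
    proof (intro ballI allI)
      fix v w c d assume v: "v \<in> ?V" and w: "w \<in> ?V"
      have "B u (\<lambda>x. c * v x + d * w x)
          = integral\<^sup>L M (\<lambda>x. c * E (u x, D u x, v x, D v x) + d * E (u x, D u x, w x, D w x))
            - integral\<^sup>L M (\<lambda>x. c * (f x * v x) + d * (f x * w x))"
        using u v w by (simp add: B_eq comb D_comb E_comb algebra_simps)
      also have "\<dots> = c *\<^sub>R B u v + d *\<^sub>R B u w"
        using u v w E_int fv_int by (simp add: B_eq right_diff_distrib)
      finally show "B u (\<lambda>x. c * v x + d * w x) = c *\<^sub>R B u v + d *\<^sub>R B u w" .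
    qed
    \<comment> \<open>Poincare-Friedrichs makes \<open>w\<close> vanish almost everywhere along with
      its gradient, and with them both integrands.\<close>
    show "B u w = 0" if u: "u \<in> ?V" and w: "w \<in> ?V" and "a w w = 0" for u w
    proof -
      have "integral\<^sup>L M (\<lambda>x. (w x)\<^sup>2) = 0"
        using poincare[OF w] \<open>a w w = 0\<close> by (simp add: order_antisym)
      then have w0: "AE x in M. w x = 0"
        using integral_nonneg_eq_0_iff_AE[OF v2_int[OF w]] by simp
      have D0: "AE x in M. D w x = 0"
        using integral_nonneg_eq_0_iff_AE[OF D_inner[OF w w]] \<open>a w w = 0\<close> by (simp add: a_eq)
      have "integral\<^sup>L M (\<lambda>x. E (u x, D u x, w x, D w x)) = 0"
        using w0 D0 by (intro integral_eq_zero_AE, eventually_elim) (simp add: E_def nc_integrand_def)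
      moreover have "integral\<^sup>L M (\<lambda>x. f x * w x) = 0"
        using w0 by (intro integral_eq_zero_AE, eventually_elim) simp
      ultimately show ?thesis by (simp add: B_eq[OF u w])
    qed
    show "continuous_on UNIV (\<lambda>x::nat \<Rightarrow> real. B (\<lambda>p. \<Sum>i<n. x i * b i p) w)"
      if b: "\<And>i. i < n \<Longrightarrow> b i \<in> ?V" and w: "w \<in> ?V" for n b w
    proof -
      let ?S = "\<lambda>(x::nat \<Rightarrow> real) p. \<Sum>i<n. x i * b i p"
      \<comment> \<open>The argument of \<open>E\<close> splits into the fixed data of the test
        function and a part linear in the coefficients, each with zeros in the slots of the
        other.\<close>
      let ?base = "\<lambda>p. (0::real, 0::real^2, w p, D w p)"
      let ?z = "\<lambda>i p. (b i p, D (b i) p, 0::real, 0::real^2)"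
      have S: "?S x \<in> ?V" for x using b by (intro sum_mem) auto
      have DS: "D (?S x) p = (\<Sum>i<n. x i *\<^sub>R D (b i) p)" for x p
      proof (rule linear_functional_sum)
        show "linear_functional (\<lambda>v. D v p)" by (simp add: linear_functional_def D_comb)
      qed (use b in auto)
      have "?base p + (\<Sum>i<n. x i *\<^sub>R ?z i p) = (?S x p, D (?S x) p, w p, D w p)" for x p
        by (simp add: DS prod_eq_iff fst_sum snd_sum)
      moreover have "continuous_on UNIV (\<lambda>x::nat \<Rightarrow> real. integral\<^sup>L M (\<lambda>p. E (?base p + (\<Sum>i<n. x i *\<^sub>R ?z i p))))"
        using b w
        by (intro continuous_on_integral_superposition fin E_cont ess_bounded_Pair vb Db ess_bounded_const)
      ultimately have "continuous_on UNIV (\<lambda>x. integral\<^sup>L M (\<lambda>p. E (?S x p, D (?S x) p, w p, D w p)))"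
        by simp
      then show ?thesis
        unfolding B_eq[OF S w] by (intro continuous_intros)
    qed
    show "B v v > 0" if "v \<in> ?V" "a v v = R\<^sup>2" for v
    proof -
      have "m / 2 * a v v = C / (2 * m) * F + 1"
        using \<open>m > 0\<close> by (simp add: that R)
      then show ?thesis using lower[OF that(1)] by linarith
    qed
  qed (rule R)
  then show ?thesis by (simp add: B_def)
qed

end
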